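(* Let $E$ be a Banach space, $0\le r<\infty$, $I^r=[-r,0]$, and let $H\subset\mathrm{Map}(I^r,E)$ be a history space. Assume that $\boldsymbol 0$ is closed under prolongations in $H$ (so that $C(I^r,E)\subset H$). Then the following properties are equivalent: (a) $H$ is regulated by prolongations. (b) The topology of $H$ (restricted to $C(I^r,E)$) is coarser than or equal to the topology of uniform convergence on $C(I^r,E)$; that is, the inclusion map $\bigl(C(I^r,E),\|\cdot\|_\infty\bigr)\to H$ is continuous.
   Context: $\mathbb{R}_+=[0,\infty)$. $\mathrm{Map}(I,E)$ is the linear space of all maps $I\to E$; $\boldsymbol 0$ is the zero map. A history space is a linear subspace $H\subset\mathrm{Map}(I,E)$ with a topology for which the linear operations are continuous. For an interval $J$, $J+I=\{t+\theta:t\in J,\theta\in I\}$; for $\gamma\colon J+I\to E$ and $t\in J$, $I_t\gamma\in\mathrm{Map}(I,E)$ is $I_t\gamma(\theta)=\gamma(t+\theta)$. Here $I=I^r$. A prolongation of $\boldsymbol 0$ is a map $\gamma\colon J+I\to E$, where $J$ is an interval with left end point $0\in J$ ($J=\{0\}$ allowed), with $\gamma(\theta)=0$ for $\theta\in I$ and $\gamma|_J$ continuous. "$\boldsymbol 0$ is closed under prolongations in $H$" means that $I_t\gamma\in H$ for all $t\ge0$ and every prolongation $\gamma\colon\mathbb{R}_++I\to E$ of $\boldsymbol 0$. For $T\ge0$ and $0\le\delta\le\infty$, $\varGamma_{0,\boldsymbol 0}(T,\delta)$ is the set of prolongations $\gamma\colon[0,T]+I\to E$ of $\boldsymbol 0$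 with $\sup_{s\in[0,T]}\|\gamma(s)\|_E\le\delta$, and $$\varLambda_{0,\boldsymbol 0}(T,\delta)=\bigcup_{\tau\in[0,T]}\{(\tau,I_\tau\gamma):\gamma\in\varGamma_{0,\boldsymbol 0}(\tau,\delta)\}.$$ $H$ is regulated by prolongations if for every $T>0$ and every neighborhood $N$ of $\boldsymbol 0$ in $H$ there is $\delta>0$ with $\varLambda_{0,\boldsymbol 0}(T,\delta)\subset[0,T]\times N$. *)

theory Defs
  imports "HOL-Analysis.Analysis"
begin

(* Maps I \<rightarrow> E are the extensional functions in I \<rightarrow>\<^sub>E UNIV, so that two maps agree iff they agree
   on I; the linear operations are therefore followed by restriction to I. *)

definition map_zero :: "real set \<Rightarrow> real \<Rightarrow> 'a::real_normed_vector" where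
  "map_zero I = (\<lambda>\<theta>\<in>I. 0)"

definition map_add :: "real set \<Rightarrow> (real \<Rightarrow> 'a::real_normed_vector) \<Rightarrow> (real \<Rightarrow> 'a) \<Rightarrow> real \<Rightarrow> 'a" where
  "map_add I f g = (\<lambda>\<theta>\<in>I. f \<theta> + g \<theta>)"

definition map_scale :: "real set \<Rightarrow> real \<Rightarrow> (real \<Rightarrow> 'a::real_normed_vector) \<Rightarrow> real \<Rightarrow> 'a" where
  "map_scale I c f = (\<lambda>\<theta>\<in>I. c *\<^sub>R f \<theta>)"

(* The topology X on H is not assumed to be Hausdorff or locally convex. *)
definition history_space ::
    "real set \<Rightarrow> (real \<Rightarrow> 'a::real_normed_vector) set \<Rightarrow> (real \<Rightarrow> 'a) topology \<Rightarrow> bool" where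
  "history_space I H X \<longleftrightarrow>
     H \<subseteq> (I \<rightarrow>\<^sub>E UNIV) \<and>
     map_zero I \<in> H \<and>
     (\<forall>f\<in>H. \<forall>g\<in>H. map_add I f g \<in> H) \<and>
     (\<forall>c. \<forall>f\<in>H. map_scale I c f \<in> H) \<and>
     topspace X = H \<and>
     continuous_map (prod_topology X X) X (\<lambda>(f, g). map_add I f g) \<and>
     continuous_map (prod_topology euclideanreal X) X (\<lambda>(c, f). map_scale I c f)"

definition hist :: "real set \<Rightarrow> real \<Rightarrow> (real \<Rightarrow> 'a) \<Rightarrow> real \<Rightarrow> 'a" where
  "hist I t \<gamma> = (\<lambda>\<theta>\<in>I. \<gamma> (t + \<theta>))"

(* J + I is the Minkowski sum. *)
definition prolongation_of_zero ::
    "real set \<Rightarrow> real set \<Rightarrow> (real \<Rightarrow> 'a::real_normed_vector) \<Rightarrow> bool" where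
  "prolongation_of_zero I J \<gamma> \<longleftrightarrow>
     is_interval J \<and> 0 \<in> J \<and> J \<subseteq> {0..} \<and>
     \<gamma> \<in> (J + I) \<rightarrow>\<^sub>E UNIV \<and> (\<forall>\<theta>\<in>I. \<gamma> \<theta> = 0) \<and> continuous_on J \<gamma>"

definition zero_closed_under_prolongations ::
    "real set \<Rightarrow> (real \<Rightarrow> 'a::real_normed_vector) set \<Rightarrow> bool" where
  "zero_closed_under_prolongations I H \<longleftrightarrow>
     (\<forall>\<gamma> t. prolongation_of_zero I {0..} \<gamma> \<longrightarrow> 0 \<le> t \<longrightarrow> hist I t \<gamma> \<in> H)"

definition Gamma_zero ::
    "real set \<Rightarrow> real \<Rightarrow> ennreal \<Rightarrow> (real \<Rightarrow> 'a::real_normed_vector) set" where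
  "Gamma_zero I T \<delta> =
     {\<gamma>. prolongation_of_zero I {0..T} \<gamma> \<and> (SUP s\<in>{0..T}. ennreal (norm (\<gamma> s))) \<le> \<delta>}"

definition Lambda_zero ::
    "real set \<Rightarrow> real \<Rightarrow> ennreal \<Rightarrow> (real \<times> (real \<Rightarrow> 'a::real_normed_vector)) set" where
  "Lambda_zero I T \<delta> = (\<Union>\<tau>\<in>{0..T}. {(\<tau>, hist I \<tau> \<gamma>) |\<gamma>. \<gamma> \<in> Gamma_zero I \<tau> \<delta>})"

definition regulated_by_prolongations ::
    "real set \<Rightarrow> (real \<Rightarrow> 'a::real_normed_vector) topology \<Rightarrow> bool" where
  "regulated_by_prolongations I X \<longleftrightarrow>
     (\<forall>T>0. \<forall>N. N \<subseteq> topspace X \<and> (\<exists>U. openin X U \<and> map_zero I \<in> U \<and> U \<subseteq> N) \<longrightarrow>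
        (\<exists>\<delta>>0. Lambda_zero I T \<delta> \<subseteq> {0..T} \<times> N))"

definition cont_maps :: "real set \<Rightarrow> (real \<Rightarrow> 'a::real_normed_vector) set" where
  "cont_maps I = {f \<in> I \<rightarrow>\<^sub>E UNIV. continuous_on I f}"

(* The value 0 off cont_maps I is only there because the locale Metric_space requires
   nonnegativity and symmetry of the distance on the whole type. *)
definition sup_dist ::
    "real set \<Rightarrow> (real \<Rightarrow> 'a::real_normed_vector) \<Rightarrow> (real \<Rightarrow> 'a) \<Rightarrow> real" where
  "sup_dist I f g =
     (if f \<in> cont_maps I \<and> g \<in> cont_maps I then SUP \<theta>\<in>I. norm (f \<theta> - g \<theta>) else 0)"

definition uniform_topology :: "real set \<Rightarrow> (real \<Rightarrow> 'a::real_normed_vector) topology" where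
  "uniform_topology I = Metric_space.mtopology (cont_maps I) (sup_dist I)"

lemma Metric_space_sup_dist:
  assumes "compact I" "I \<noteq> {}"
  shows "Metric_space (cont_maps I :: (real \<Rightarrow> 'a::real_normed_vector) set) (sup_dist I)"
proof -
  let ?C = "cont_maps I :: (real \<Rightarrow> 'a) set"
  have bdd: "bdd_above ((\<lambda>\<theta>. norm (f \<theta> - g \<theta>)) ` I)" if "f \<in> ?C" "g \<in> ?C" for f g
  proof -
    have "continuous_on I (\<lambda>\<theta>. norm (f \<theta> - g \<theta>))"
      using that by (auto simp: cont_maps_def intro!: continuous_intros)
    then show ?thesis
      using assms(1) by (intro bounded_imp_bdd_above compact_imp_bounded compact_continuous_image)
  qed
  have upper: "norm (f \<theta> - g \<theta>) \<le> sup_dist I f g" if "f \<in> ?C" "g \<in> ?C" "\<theta> \<in> I" for f g \<theta>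
    using cSUP_upper[OF that(3) bdd[OF that(1,2)]] that by (simp add: sup_dist_def)
  obtain \<theta>0 where \<theta>0: "\<theta>0 \<in> I" using assms(2) by auto
  show ?thesis
  proof
    show "0 \<le> sup_dist I f g" for f g :: "real \<Rightarrow> 'a"
    proof (cases "f \<in> ?C \<and> g \<in> ?C")
      case True
      then show ?thesis using upper[of f g \<theta>0] \<theta>0 norm_ge_zero order_trans by blast
    qed (auto simp: sup_dist_def)
    show "sup_dist I f g = sup_dist I g f" for f g :: "real \<Rightarrow> 'a"
      by (auto simp: sup_dist_def norm_minus_commute)
    show "sup_dist I f g = 0 \<longleftrightarrow> f = g" if "f \<in> ?C" "g \<in> ?C" for f g
    proof
      assume "sup_dist I f g = 0"
      then have "f \<theta> = g \<theta>" if "\<theta> \<in> I" for \<theta>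
        using upper[of f g \<theta>] that \<open>f \<in> ?C\<close> \<open>g \<in> ?C\<close> by auto
      moreover have "f \<in> extensional I" "g \<in> extensional I"
        using that by (auto simp: cont_maps_def PiE_def)
      ultimately show "f = g" by (metis extensionalityI)
    next
      assume "f = g"
      then show "sup_dist I f g = 0" using assms(2) by (auto simp: sup_dist_def)
    qed
    show "sup_dist I f h \<le> sup_dist I f g + sup_dist I g h"
      if "f \<in> ?C" "g \<in> ?C" "h \<in> ?C" for f g h
    proof -
      have "norm (f \<theta> - h \<theta>) \<le> sup_dist I f g + sup_dist I g h" if "\<theta> \<in> I" for \<theta>
        using upper[of f g \<theta>] upper[of g h \<theta>] norm_triangle_ineq[of "f \<theta> - g \<theta>" "g \<theta> - h \<theta>"]
          that \<open>f \<in> ?C\<close> \<open>g \<in> ?C\<close> \<open>h \<in> ?C\<close> by auto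
      then have "(SUP \<theta>\<in>I. norm (f \<theta> - h \<theta>)) \<le> sup_dist I f g + sup_dist I g h"
        using assms(2) by (intro cSUP_least) auto
      then show ?thesis using that by (simp add: sup_dist_def)
    qed
  qed
qed

end

theory Submission
  imports Defs
begin

text \<open>
  Prolongations of \<open>\<zero>\<close> and continuous histories are two descriptions of the same objects, and the
  suprema of their norms correspond.

  In one direction, a prolongation \<open>\<gamma>\<close> of \<open>\<zero>\<close> vanishes on \<open>[-r,0]\<close> and is continuous on
  \<open>[0,\<tau>]\<close>; since both pieces contain \<open>0\<close>, it is continuous on \<open>[-r,\<tau>]\<close>, so the history at \<open>\<tau>\<close> is
  continuous and inherits every bound of \<open>\<gamma>\<close> (\<open>hist_prolongation_cont_maps\<close>,
  \<open>norm_hist_prolongation_le\<close>).  Hence a uniform neighbourhood of \<open>\<zero>\<close> contains all histories of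
  sufficiently small prolongations, whatever the time, and (b) implies (a).

  In the other direction, every \<open>\<phi> \<in> C([-r,0],E)\<close> is the history at time \<open>1 + r\<close> of a prolongation
  that climbs linearly from \<open>0\<close> to \<open>\<phi>(-r)\<close> during \<open>[0,1]\<close> and then runs through \<open>\<phi>\<close>
  (\<open>ramp_prolongation\<close>, \<open>hist_ramp\<close>); its norm never exceeds the supremum norm of \<open>\<phi>\<close>.  This gives
  \<open>C([-r,0],E) \<subseteq> H\<close>, and with regulation at the single time horizon \<open>T = 1 + r\<close> it shows that every
  neighbourhood of \<open>\<zero>\<close> in \<open>H\<close> contains a uniform ball.  Continuity of addition in \<open>H\<close> transports this
  from \<open>\<zero>\<close> to the other points of \<open>C([-r,0],E)\<close>, so (a) implies (b).
\<close>

section \<open>The supremum distance\<close>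

lemma norm_diff_le_sup_dist:
  assumes "compact I" "f \<in> cont_maps I" "g \<in> cont_maps I" "\<theta> \<in> I"
  shows "norm (f \<theta> - g \<theta>) \<le> sup_dist I f g"
proof -
  have "continuous_on I (\<lambda>\<theta>. norm (f \<theta> - g \<theta>))"
    using assms by (auto simp: cont_maps_def intro!: continuous_intros)
  then have "bdd_above ((\<lambda>\<theta>. norm (f \<theta> - g \<theta>)) ` I)"
    using assms(1) by (intro bounded_imp_bdd_above compact_imp_bounded compact_continuous_image)
  from cSUP_upper[OF assms(4) this] show ?thesis
    using assms by (simp add: sup_dist_def)
qed

lemma sup_dist_le:
  assumes "I \<noteq> {}" "f \<in> cont_maps I" "g \<in> cont_maps I"
    and "\<And>\<theta>. \<theta> \<in> I \<Longrightarrow> norm (f \<theta> - g \<theta>) \<le> e"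
  shows "sup_dist I f g \<le> e"
  using assms by (auto simp: sup_dist_def intro!: cSUP_least)

lemma map_zero_cont_maps: "map_zero I \<in> cont_maps I"
  by (auto simp: map_zero_def cont_maps_def intro: continuous_on_eq[OF continuous_on_const])

lemma openin_uniform_topology_iff:
  assumes "0 \<le> r"
  shows "openin (uniform_topology {-r..0}) U \<longleftrightarrow>
    U \<subseteq> cont_maps {-r..0} \<and>
    (\<forall>f\<in>U. \<exists>e>0. \<forall>g\<in>cont_maps {-r..0}. sup_dist {-r..0} f g < e \<longrightarrow> g \<in> U)"
proof -
  interpret Metric_space "cont_maps {-r..0} :: (real \<Rightarrow> 'a) set" "sup_dist {-r..0}"
    using assms by (intro Metric_space_sup_dist) auto
  show ?thesis
    unfolding uniform_topology_def openin_mtopology subset_iff in_mball by blast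
qed

lemma topspace_uniform_topology:
  assumes "0 \<le> r"
  shows "topspace (uniform_topology {-r..0}) = cont_maps {-r..0}"
proof -
  interpret Metric_space "cont_maps {-r..0} :: (real \<Rightarrow> 'a) set" "sup_dist {-r..0}"
    using assms by (intro Metric_space_sup_dist) auto
  show ?thesis
    by (simp add: uniform_topology_def)
qed

section \<open>Histories of prolongations are continuous\<close>

lemma hist_prolongation_cont_maps:
  assumes "0 \<le> r" "prolongation_of_zero {-r..0} {0..\<tau>} \<gamma>"
  shows "hist {-r..0} \<tau> \<gamma> \<in> cont_maps {-r..0}"
proof -
  have \<gamma>: "\<gamma> \<theta> = 0" if "\<theta> \<in> {-r..0}" for \<theta>
    using assms(2) that by (auto simp: prolongation_of_zero_def)
  have "continuous_on {-r..0} \<gamma>"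
    using \<gamma> by (auto intro: continuous_on_eq[OF continuous_on_const])
  moreover have "continuous_on {0..\<tau>} \<gamma>"
    using assms(2) by (simp add: prolongation_of_zero_def)
  ultimately have "continuous_on ({-r..0} \<union> {0..\<tau>}) \<gamma>"
    by (intro continuous_on_closed_Un) auto
  then have "continuous_on {-r..0} (\<lambda>\<theta>. \<gamma> (\<tau> + \<theta>))"
    by (rule continuous_on_compose2)
       (use assms(2) in \<open>auto simp: prolongation_of_zero_def intro!: continuous_intros\<close>)
  then show ?thesis
    by (auto simp: cont_maps_def hist_def intro: continuous_on_eq)
qed

lemma norm_hist_prolongation_le:
  assumes "prolongation_of_zero {-r..0} {0..\<tau>} \<gamma>" "0 \<le> e"
    and bound: "\<And>s. s \<in> {0..\<tau>} \<Longrightarrow> norm (\<gamma> s) \<le> e"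
    and "\<theta> \<in> {-r..0}"
  shows "norm (hist {-r..0} \<tau> \<gamma> \<theta>) \<le> e"
proof (cases "0 \<le> \<tau> + \<theta>")
  case True
  then show ?thesis
    using bound[of "\<tau> + \<theta>"] assms(4) by (simp add: hist_def)
next
  case False
  have "0 \<le> \<tau>"
    using assms(1) by (simp add: prolongation_of_zero_def)
  then have "\<gamma> (\<tau> + \<theta>) = 0"
    using False assms(1,4) by (auto simp: prolongation_of_zero_def)
  then show ?thesis
    using assms by (simp add: hist_def)
qed

lemma Gamma_zero_real:
  assumes "0 \<le> e"
  shows "\<gamma> \<in> Gamma_zero I T (ennreal e) \<longleftrightarrow>
    prolongation_of_zero I {0..T} \<gamma> \<and> (\<forall>s\<in>{0..T}. norm (\<gamma> s) \<le> e)"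
  using assms by (simp add: Gamma_zero_def SUP_le_iff ennreal_le_iff)

section \<open>Continuous maps are histories of prolongations\<close>

text \<open>
  The linear climb to \<open>\<phi>(-r)\<close> takes place on \<open>[0,1]\<close>, where the clamped argument of \<open>\<phi>\<close> is still \<open>-r\<close>;
  afterwards the factor is \<open>1\<close> and the argument sweeps \<open>[-r,0]\<close> during \<open>[1,1 + r]\<close>.  Clamping
  both makes continuity on the whole line immediate.
\<close>

definition ramp :: "real \<Rightarrow> (real \<Rightarrow> 'a::real_normed_vector) \<Rightarrow> real \<Rightarrow> 'a" where
  "ramp r \<phi> s = min 1 (max 0 s) *\<^sub>R \<phi> (max (-r) (min 0 (s - 1 - r)))"

lemma norm_ramp_le:
  assumes "0 \<le> r" "\<And>\<theta>. \<theta> \<in> {-r..0} \<Longrightarrow> norm (\<phi> \<theta>) \<le> e"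
  shows "norm (ramp r \<phi> s) \<le> e"
proof -
  have "norm (ramp r \<phi> s) \<le> norm (\<phi> (max (-r) (min 0 (s - 1 - r))))"
    unfolding ramp_def norm_scaleR by (intro mult_left_le_one_le) auto
  also have "\<dots> \<le> e"
    using assms(1) by (intro assms(2)) auto
  finally show ?thesis .
qed

lemma ramp_prolongation:
  assumes "0 \<le> r" "\<phi> \<in> cont_maps {-r..0}" "is_interval J" "0 \<in> J" "J \<subseteq> {0..}"
  shows "prolongation_of_zero {-r..0} J (restrict (ramp r \<phi>) (J + {-r..0}))"
proof -
  have sub: "s \<in> J + {-r..0}" if "s \<in> J \<or> s \<in> {-r..0}" for s
    using that set_plus_intro[of s J 0 "{-r..0}"] set_plus_intro[of 0 J s "{-r..0}"] assms(1,4)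
    by auto
  have "continuous_on J (\<lambda>s. \<phi> (max (-r) (min 0 (s - 1 - r))))"
  proof (rule continuous_on_compose2[of "{-r..0}" \<phi>])
    show "continuous_on {-r..0} \<phi>"
      using assms(2) by (simp add: cont_maps_def)
    show "continuous_on J (\<lambda>s. max (-r) (min 0 (s - 1 - r)))"
      by (intro continuous_intros)
  qed (use assms(1) in auto)
  then have "continuous_on J (ramp r \<phi>)"
    unfolding ramp_def by (intro continuous_intros)
  then have "continuous_on J (restrict (ramp r \<phi>) (J + {-r..0}))"
    using sub by (elim continuous_on_eq) simp
  then show ?thesis
    using assms(3-5) sub by (auto simp: prolongation_of_zero_def ramp_def)
qed

lemma hist_ramp:
  assumes "\<phi> \<in> cont_maps {-r..0}" "1 + r \<in> J"
  shows "hist {-r..0} (1 + r) (restrict (ramp r \<phi>) (J + {-r..0})) = \<phi>"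
proof
  fix \<theta>
  show "hist {-r..0} (1 + r) (restrict (ramp r \<phi>) (J + {-r..0})) \<theta> = \<phi> \<theta>"
  proof (cases "\<theta> \<in> {-r..0}")
    case True
    then have "1 + r + \<theta> \<in> J + {-r..0}"
      using assms(2) by (intro set_plus_intro)
    moreover have "min 1 (max 0 (1 + r + \<theta>)) = 1" "max (-r) (min 0 (1 + r + \<theta> - 1 - r)) = \<theta>"
      using True by auto
    ultimately show ?thesis
      using True by (simp only: hist_def ramp_def restrict_apply' scaleR_one)
  next
    case False
    moreover have "\<phi> \<in> extensional {-r..0}"
      using assms(1) by (simp add: cont_maps_def PiE_def)
    ultimately show ?thesis
      using extensional_arb[of \<phi> "{-r..0}" \<theta>] False
      by (simp only: hist_def restrict_def if_False simp_thms not_False_eq_True)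
  qed
qed

lemma cont_maps_subset:
  assumes "0 \<le> r" "zero_closed_under_prolongations {-r..0} H"
  shows "cont_maps {-r..0} \<subseteq> H"
proof
  fix \<phi> :: "real \<Rightarrow> 'a"
  assume \<phi>: "\<phi> \<in> cont_maps {-r..0}"
  have "prolongation_of_zero {-r..0} {0..} (restrict (ramp r \<phi>) ({0..} + {-r..0}))"
    using assms(1) \<phi> by (intro ramp_prolongation) (auto simp: is_interval_ci)
  moreover have "0 \<le> 1 + r" "1 + r \<in> {0..}"
    using assms(1) by simp_all
  ultimately have "hist {-r..0} (1 + r) (restrict (ramp r \<phi>) ({0..} + {-r..0})) \<in> H"
    using assms(2) unfolding zero_closed_under_prolongations_def by blast
  then show "\<phi> \<in> H"
    unfolding hist_ramp[OF \<phi> \<open>1 + r \<in> {0..}\<close>] .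
qed

text \<open>
  The reachable histories at time \<open>1 + r\<close> contain a uniform ball: this is what turns a regulation bound
  into a uniform neighbourhood.
\<close>

lemma small_cont_maps_in_Lambda_zero:
  assumes "0 \<le> r" "\<phi> \<in> cont_maps {-r..0}" "0 \<le> e"
    and "\<And>\<theta>. \<theta> \<in> {-r..0} \<Longrightarrow> norm (\<phi> \<theta>) \<le> e" "ennreal e \<le> \<delta>"
  shows "(1 + r, \<phi>) \<in> Lambda_zero {-r..0} (1 + r) \<delta>"
proof -
  let ?J = "{0..1 + r}"
  let ?\<gamma> = "restrict (ramp r \<phi>) (?J + {-r..0})"
  have "prolongation_of_zero {-r..0} ?J ?\<gamma>"
    using assms(1,2) by (intro ramp_prolongation) (auto simp: is_interval_cc)
  moreover have "norm (?\<gamma> s) \<le> e" if "s \<in> ?J" for s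
  proof -
    have "s \<in> ?J + {-r..0}"
      using set_plus_intro[OF that, of 0 "{-r..0}"] assms(1) by simp
    then show ?thesis
      using norm_ramp_le[OF assms(1,4), of _ s] by simp
  qed
  ultimately have "?\<gamma> \<in> Gamma_zero {-r..0} (1 + r) (ennreal e)"
    using assms(3) by (simp add: Gamma_zero_real)
  then have "?\<gamma> \<in> Gamma_zero {-r..0} (1 + r) \<delta>"
    using assms(5) by (auto simp: Gamma_zero_def)
  then have "(1 + r, hist {-r..0} (1 + r) ?\<gamma>) \<in> Lambda_zero {-r..0} (1 + r) \<delta>"
    unfolding Lambda_zero_def using assms(1) by (intro UN_I[of "1 + r"] CollectI exI conjI) simp_all
  moreover have "hist {-r..0} (1 + r) ?\<gamma> = \<phi>"
    using assms(1,2) by (intro hist_ramp) auto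
  ultimately show ?thesis
    by (simp only:)
qed

section \<open>The two implications\<close>

text \<open>
  For \<open>f \<in> U\<close> the preimage is a neighbourhood of \<open>\<zero>\<close>, the only point at which regulation by
  prolongations gives information directly.
\<close>

lemma openin_translate_preimage:
  assumes "history_space I H X" "f \<in> H" "openin X U"
  shows "openin X {g \<in> H. map_add I f g \<in> U}"
proof -
  have top: "topspace X = H"
    and add: "continuous_map (prod_topology X X) X (\<lambda>(f, g). map_add I f g)"
    using assms(1) by (simp_all add: history_space_def)
  have "continuous_map X (prod_topology X X) (\<lambda>g. (f, g))"
    using assms(2) top by (simp add: continuous_map_paired)
  then have "continuous_map X X (map_add I f)"
    using continuous_map_compose[OF _ add] by (fastforce simp: o_def)
  then show ?thesis
    using openin_continuous_map_preimage[OF _ assms(3)] top by fastforce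
qed

lemma regulated_imp_continuous_inclusion:
  assumes "0 \<le> r" "history_space {-r..0} H X" "cont_maps {-r..0} \<subseteq> H"
    and "regulated_by_prolongations {-r..0} X"
  shows "continuous_map (uniform_topology {-r..0}) X (\<lambda>\<phi>. \<phi>)"
proof -
  let ?I = "{-r..0}"
  have top: "topspace X = H"
    using assms(2) by (simp add: history_space_def)
  have "openin (uniform_topology ?I) {\<phi> \<in> cont_maps ?I. \<phi> \<in> U}" if U: "openin X U" for U
    unfolding openin_uniform_topology_iff[OF assms(1)]
  proof (intro conjI ballI)
    fix \<phi> assume \<phi>: "\<phi> \<in> {\<phi> \<in> cont_maps ?I. \<phi> \<in> U}"
    define V where "V = {g \<in> H. map_add ?I \<phi> g \<in> U}"
    have ext: "\<phi> \<in> extensional ?I"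
      using \<phi> by (auto simp: cont_maps_def PiE_def)
    have "map_add ?I \<phi> (map_zero ?I) = \<phi>"
      by (rule extensionalityI[OF _ ext]) (auto simp: map_add_def map_zero_def)
    then have "map_zero ?I \<in> V"
      using \<phi> assms(2) by (simp add: V_def history_space_def)
    moreover have "openin X V"
      unfolding V_def using \<phi> assms(3) by (intro openin_translate_preimage[OF assms(2) _ U]) auto
    moreover have "V \<subseteq> topspace X"
      by (auto simp: V_def top)
    moreover have "1 + r > 0"
      using assms(1) by simp
    ultimately obtain \<delta> where "\<delta> > 0" and \<delta>: "Lambda_zero ?I (1 + r) \<delta> \<subseteq> {0..1 + r} \<times> V"
      using assms(4) unfolding regulated_by_prolongations_def by blast
    \<comment> \<open>The bound \<open>\<delta>\<close> may be infinite, whereas the radius of a uniform ball is real.\<close>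
    obtain e where e: "0 < e" "ennreal e \<le> \<delta>"
    proof (cases \<delta>)
      case (real x)
      then show ?thesis
        using that[of x] \<open>\<delta> > 0\<close> by simp
    next
      case top
      then show ?thesis
        using that[of 1] by simp
    qed
    have "\<psi> \<in> U" if \<psi>: "\<psi> \<in> cont_maps ?I" "sup_dist ?I \<phi> \<psi> < e" for \<psi>
    proof -
      define \<eta> where "\<eta> = (\<lambda>\<theta>\<in>?I. \<psi> \<theta> - \<phi> \<theta>)"
      have "continuous_on ?I (\<lambda>\<theta>. \<psi> \<theta> - \<phi> \<theta>)"
        using \<phi> \<psi>(1) by (auto simp: cont_maps_def intro!: continuous_intros)
      then have "\<eta> \<in> cont_maps ?I"
        by (auto simp: cont_maps_def \<eta>_def intro: continuous_on_eq)
      moreover have "norm (\<eta> \<theta>) \<le> e" if "\<theta> \<in> ?I" for \<theta>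
        using norm_diff_le_sup_dist[OF _ _ \<psi>(1) that, of \<phi>] \<phi> \<psi>(2) that
        by (simp add: \<eta>_def norm_minus_commute)
      ultimately have "(1 + r, \<eta>) \<in> Lambda_zero ?I (1 + r) \<delta>"
        using assms(1) e by (intro small_cont_maps_in_Lambda_zero[of r \<eta> e]) auto
      then have "map_add ?I \<phi> \<eta> \<in> U"
        using \<delta> by (auto simp: V_def)
      moreover have "map_add ?I \<phi> \<eta> = \<psi>"
        using \<psi>(1) by (intro extensionalityI[of _ ?I])
          (auto simp: map_add_def \<eta>_def cont_maps_def PiE_def)
      ultimately show ?thesis by simp
    qed
    then show "\<exists>e>0. \<forall>\<psi>\<in>cont_maps ?I. sup_dist ?I \<phi> \<psi> < e \<longrightarrow> \<psi> \<in> {\<phi> \<in> cont_maps ?I. \<phi> \<in> U}"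
      using e(1) by blast
  qed auto
  then show ?thesis
    using assms(3) top by (auto simp: continuous_map_def topspace_uniform_topology[OF assms(1)])
qed

lemma continuous_inclusion_imp_regulated:
  assumes "0 \<le> r" "continuous_map (uniform_topology {-r..0}) X (\<lambda>\<phi>. \<phi>)"
  shows "regulated_by_prolongations {-r..0} X"
  unfolding regulated_by_prolongations_def
proof (intro allI impI, elim conjE exE)
  let ?I = "{-r..0}"
  fix T :: real and N U
  assume U: "openin X U" "map_zero ?I \<in> U" "U \<subseteq> N"
  have "openin (uniform_topology ?I) {\<phi> \<in> cont_maps ?I. \<phi> \<in> U}"
    using openin_continuous_map_preimage[OF assms(2) U(1)]
    by (simp add: topspace_uniform_topology[OF assms(1)])
  then obtain e where e: "e > 0"
    and ball: "\<And>\<psi>. \<psi> \<in> cont_maps ?I \<Longrightarrow> sup_dist ?I (map_zero ?I) \<psi> < e \<Longrightarrow> \<psi> \<in> U"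
    using U(2) map_zero_cont_maps[of ?I] unfolding openin_uniform_topology_iff[OF assms(1)] by blast
  have "hist ?I \<tau> \<gamma> \<in> N" if "\<gamma> \<in> Gamma_zero ?I \<tau> (ennreal (e / 2))" for \<tau> \<gamma>
  proof -
    have \<gamma>: "prolongation_of_zero ?I {0..\<tau>} \<gamma>" "\<And>s. s \<in> {0..\<tau>} \<Longrightarrow> norm (\<gamma> s) \<le> e / 2"
      using that e by (simp_all add: Gamma_zero_real)
    have C: "hist ?I \<tau> \<gamma> \<in> cont_maps ?I"
      by (rule hist_prolongation_cont_maps[OF assms(1) \<gamma>(1)])
    have "sup_dist ?I (map_zero ?I) (hist ?I \<tau> \<gamma>) \<le> e / 2"
      using assms(1) e norm_hist_prolongation_le[OF \<gamma>(1) _ \<gamma>(2)]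
      by (intro sup_dist_le map_zero_cont_maps C) (auto simp: map_zero_def)
    then show ?thesis
      using ball[OF C] e U(3) by auto
  qed
  then have "Lambda_zero ?I T (ennreal (e / 2)) \<subseteq> {0..T} \<times> N"
    by (auto simp: Lambda_zero_def)
  moreover have "ennreal (e / 2) > 0"
    using e by simp
  ultimately show "\<exists>\<delta>>0. Lambda_zero ?I T \<delta> \<subseteq> {0..T} \<times> N"
    by blast
qed

lemma continuous_map_inclusion_iff_coarser:
  assumes "topspace Y \<subseteq> topspace X"
  shows "continuous_map Y X (\<lambda>x. x) \<longleftrightarrow>
    (\<forall>U. openin (subtopology X (topspace Y)) U \<longrightarrow> openin Y U)"
proof -
  have "{x \<in> topspace Y. x \<in> U} = U \<inter> topspace Y" for U
    by blast
  then show ?thesis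
    using assms by (simp add: continuous_map_def openin_subtopology image_subset_iff Pi_iff) blast
qed

theorem theorem3p11:
  fixes r :: real
    and H :: "(real \<Rightarrow> 'a::banach) set"
    and X :: "(real \<Rightarrow> 'a) topology"
  assumes "0 \<le> r"
    and "history_space {-r..0} H X"
    and "zero_closed_under_prolongations {-r..0} H"
  shows "cont_maps {-r..0} \<subseteq> H \<and>
    (regulated_by_prolongations {-r..0} X \<longleftrightarrow>
      (\<forall>U. openin (subtopology X (cont_maps {-r..0})) U \<longrightarrow> openin (uniform_topology {-r..0}) U)) \<and>
    (regulated_by_prolongations {-r..0} X \<longleftrightarrow>
      continuous_map (uniform_topology {-r..0}) X (\<lambda>\<phi>. \<phi>))"
proof -
  have sub: "cont_maps {-r..0} \<subseteq> H"
    by (rule cont_maps_subset[OF assms(1,3)])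
  have "regulated_by_prolongations {-r..0} X \<longleftrightarrow>
      continuous_map (uniform_topology {-r..0}) X (\<lambda>\<phi>. \<phi>)"
    using regulated_imp_continuous_inclusion[OF assms(1,2) sub]
      continuous_inclusion_imp_regulated[OF assms(1)] by blast
  moreover have "topspace X = H"
    using assms(2) by (simp add: history_space_def)
  ultimately show ?thesis
    using sub continuous_map_inclusion_iff_coarser[of "uniform_topology {-r..0}" X]
    by (simp add: topspace_uniform_topology[OF assms(1)])
qed

end
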